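(* Let $S$ be a semigroup and let $R_i=\bigoplus_{s\in S} R_i^{(s)}$, $i=1,2$, be two $S$-graded-simple rings such that $R_i \ne J(R_i)$ for both $i=1,2$. Let $\pi_i \colon R_i \rightarrow R_i/J(R_i)$, $i=1,2$, be the natural epimorphisms. (a) If there exists a ring isomorphism $\bar\varphi \colon R_1/J(R_1) \rightarrow R_2/J(R_2)$ such that $\bar\varphi\left(\pi_1\left(R_1^{(s)}\right)\right)=\pi_2\left(R_2^{(s)}\right)$ for every $s\in S$, then there exists an isomorphism $\varphi \colon R_1 \rightarrow R_2$ of graded rings such that $\pi_2\varphi=\bar\varphi\pi_1$. (b) Conversely, if $\varphi \colon R_1 \rightarrow R_2$ is an isomorphism of graded rings, then a ring isomorphism $\bar\varphi \colon R_1/J(R_1) \rightarrow R_2/J(R_2)$ can be defined by $\bar\varphi(\pi_1(a)) = \pi_2\varphi(a)$ for all $a \in R_1$, and it satisfies $\bar\varphi\left(\pi_1\left(R_1^{(s)}\right)\right)=\pi_2\left(R_2^{(s)}\right)$ for every $s\in S$.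
   Context: Rings are associative but need not have a unit element. $J(R)$ denotes the Jacobson radical of $R$. For a semigroup $S$, an $S$-graded ring is a ring $R=\bigoplus_{s\in S}R^{(s)}$, a direct sum of additive subgroups with $R^{(s)}R^{(t)}\subseteq R^{(st)}$ for all $s,t\in S$. An additive subgroup $P\subseteq R$ is homogeneous (graded) if $P=\bigoplus_{s\in S}(P\cap R^{(s)})$. $R$ is $S$-graded-simple if $R^2\ne 0$ and $\{0\}$ and $R$ are the only homogeneous two-sided ideals of $R$. A homomorphism $\varphi\colon R_1\to R_2$ of $S$-graded rings is graded if $\varphi(R_1^{(s)})\subseteq R_2^{(s)}$ for all $s\in S$; an isomorphism of graded rings is a graded ring isomorphism. *)

theory Defs
  imports Main "HOL-Library.Set_Algebras"
begin

text \<open>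
  Associative rings without a (chosen) unit are the members of the type class \<open>ring\<close>, semigroups
  those of \<open>semigroup_mult\<close>. Thus a ring is a whole type, while subgroups, ideals and homogeneous
  components are subsets of it.
\<close>

definition additive_subgroup :: "'a::ab_group_add set \<Rightarrow> bool" where
  "additive_subgroup P \<longleftrightarrow> 0 \<in> P \<and> (\<forall>a\<in>P. \<forall>b\<in>P. a + b \<in> P) \<and> (\<forall>a\<in>P. - a \<in> P)"

definition left_ideal :: "'a::ring set \<Rightarrow> bool" where
  "left_ideal I \<longleftrightarrow> additive_subgroup I \<and> (\<forall>r. \<forall>a\<in>I. r * a \<in> I)"

definition two_sided_ideal :: "'a::ring set \<Rightarrow> bool" where
  "two_sided_ideal I \<longleftrightarrow> left_ideal I \<and> (\<forall>r. \<forall>a\<in>I. a * r \<in> I)"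

text \<open>
  A left ideal \<open>L\<close> is modular (regular) if the ring has a right unit modulo \<open>L\<close>. The simple left
  modules of a ring without unit are, up to isomorphism, the quotients by its modular maximal left
  ideals. The Jacobson radical is the intersection of these left ideals; it is the whole ring
  if there are none.
\<close>

definition modular_left_ideal :: "'a::ring set \<Rightarrow> bool" where
  "modular_left_ideal L \<longleftrightarrow> left_ideal L \<and> (\<exists>e. \<forall>x. x - x * e \<in> L)"

definition maximal_left_ideal :: "'a::ring set \<Rightarrow> bool" where
  "maximal_left_ideal L \<longleftrightarrow> left_ideal L \<and> L \<noteq> UNIV \<and>
     (\<forall>K. left_ideal K \<and> L \<subseteq> K \<longrightarrow> K = L \<or> K = UNIV)"

definition jacobson_radical :: "'a::ring set" where
  "jacobson_radical = \<Inter>{L. modular_left_ideal L \<and> maximal_left_ideal L}"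

definition internal_direct_sum :: "'a::ab_group_add set \<Rightarrow> ('s \<Rightarrow> 'a set) \<Rightarrow> bool" where
  "internal_direct_sum P Q \<longleftrightarrow>
     (\<forall>s. additive_subgroup (Q s) \<and> Q s \<subseteq> P) \<and>
     (\<forall>a\<in>P. \<exists>!f. (\<forall>s. f s \<in> Q s) \<and> finite {s. f s \<noteq> 0} \<and> a = (\<Sum>s | f s \<noteq> 0. f s))"

definition graded_ring :: "('s::semigroup_mult \<Rightarrow> 'a::ring set) \<Rightarrow> bool" where
  "graded_ring R \<longleftrightarrow> internal_direct_sum UNIV R \<and>
     (\<forall>s t. \<forall>a\<in>R s. \<forall>b\<in>R t. a * b \<in> R (s * t))"

definition homogeneous :: "('s::semigroup_mult \<Rightarrow> 'a::ring set) \<Rightarrow> 'a set \<Rightarrow> bool" where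
  "homogeneous R P \<longleftrightarrow> additive_subgroup P \<and> internal_direct_sum P (\<lambda>s. P \<inter> R s)"

text \<open>The square of the ring is nonzero iff some product of two elements is.\<close>

definition graded_simple :: "('s::semigroup_mult \<Rightarrow> 'a::ring set) \<Rightarrow> bool" where
  "graded_simple R \<longleftrightarrow> graded_ring R \<and> (\<exists>a b :: 'a. a * b \<noteq> 0) \<and>
     (\<forall>I. two_sided_ideal I \<and> homogeneous R I \<longrightarrow> I = {0} \<or> I = UNIV)"

definition ring_iso :: "('a::ring \<Rightarrow> 'b::ring) \<Rightarrow> bool" where
  "ring_iso f \<longleftrightarrow> bij f \<and> (\<forall>a b. f (a + b) = f a + f b) \<and> (\<forall>a b. f (a * b) = f a * f b)"

definition graded_ring_iso ::
    "('s::semigroup_mult \<Rightarrow> 'a::ring set) \<Rightarrow> ('s \<Rightarrow> 'b::ring set) \<Rightarrow> ('a \<Rightarrow> 'b) \<Rightarrow> bool" where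
  "graded_ring_iso R1 R2 f \<longleftrightarrow> ring_iso f \<and> (\<forall>s. f ` R1 s \<subseteq> R2 s)"

text \<open>
  The elements of the quotient by a two-sided ideal \<open>I\<close> are the cosets \<open>a +o I\<close>. The sum of two
  cosets is their elementwise sum \<open>A + B\<close>. Their elementwise product is in general only contained
  in a coset, so the product in the quotient ring is the union of the cosets of the elementwise
  products (a single coset, since \<open>I\<close> is a two-sided ideal).
\<close>

definition quot_proj :: "'a::ring set \<Rightarrow> 'a \<Rightarrow> 'a set" where
  "quot_proj I a = a +o I"

definition quot_carrier :: "'a::ring set \<Rightarrow> 'a set set" where
  "quot_carrier I = range (quot_proj I)"

definition quot_mult :: "'a::ring set \<Rightarrow> 'a set \<Rightarrow> 'a set \<Rightarrow> 'a set" where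
  "quot_mult I A B = (\<Union>a\<in>A. \<Union>b\<in>B. quot_proj I (a * b))"

text \<open>The values of \<open>g\<close> outside the cosets of \<open>I\<close> are irrelevant.\<close>

definition quot_ring_iso ::
    "'a::ring set \<Rightarrow> 'b::ring set \<Rightarrow> ('a set \<Rightarrow> 'b set) \<Rightarrow> bool" where
  "quot_ring_iso I J g \<longleftrightarrow> bij_betw g (quot_carrier I) (quot_carrier J) \<and>
     (\<forall>A\<in>quot_carrier I. \<forall>B\<in>quot_carrier I. g (A + B) = g A + g B) \<and>
     (\<forall>A\<in>quot_carrier I. \<forall>B\<in>quot_carrier I. g (quot_mult I A B) = quot_mult J (g A) (g B))"

abbreviation jacobson_proj :: "'a::ring \<Rightarrow> 'a set"  ("\<pi>\<^sub>J") where
  "\<pi>\<^sub>J \<equiv> quot_proj jacobson_radical"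

end

theory Submission
  imports Defs
begin

text \<open>
  Since \<open>J(R)\<close> is a proper ideal of the graded-simple ring \<open>R\<close>, the homogeneous ideal generated by
  the homogeneous elements of \<open>J(R)\<close> is zero, so \<open>\<pi>\<close> is injective on every component. In
  part (a) each element of \<open>R1 s\<close> therefore has a unique partner in \<open>R2 s\<close> with corresponding image in
  the quotient, and conversely. The resulting bijections of components add up to \<open>\<phi>\<close>. It is
  multiplicative because \<open>\<phi>(a b)\<close> and \<open>\<phi>(a) \<phi>(b)\<close>, for homogeneous \<open>a\<close> and \<open>b\<close>, lie in the same
  component and have the same image under \<open>\<pi>\<close>. Part (b) holds because ring isomorphisms preserve the
  Jacobson radical.
\<close>

subsection \<open>Subgroups, ideals and quotients\<close>

lemma additive_subgroup_diff:
  assumes "additive_subgroup P" "a \<in> P" "b \<in> P"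
  shows "a - b \<in> P"
  using assms unfolding additive_subgroup_def by (metis diff_conv_add_uminus)

lemma additive_subgroup_sum:
  assumes "additive_subgroup P" "\<And>s. s \<in> A \<Longrightarrow> f s \<in> P"
  shows "sum f A \<in> P"
  using assms by (induction A rule: infinite_finite_induct) (auto simp: additive_subgroup_def)

lemma two_sided_ideal_subgroup: "two_sided_ideal I \<Longrightarrow> additive_subgroup I"
  by (simp add: two_sided_ideal_def left_ideal_def)

section \<open>Left ideals and the Jacobson radical as a two-sided ideal\<close>

text \<open>This is the left ideal that maximality of \<open>L\<close> is tested on below: modulo
  \<open>L\<close> it is the submodule of \<open>R / L\<close> formed by the multiples of the image
  of \<open>r\<close> by elements of \<open>M\<close>. Without a unit it need not contain
  \<open>r\<close>, even if \<open>M\<close> is the whole ring.\<close>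

lemma left_ideal_add_principal:
  assumes L: "left_ideal L" and M: "left_ideal M"
  shows "left_ideal {m * r + l | m l. m \<in> M \<and> l \<in> L}"
proof -
  have "additive_subgroup {m * r + l | m l. m \<in> M \<and> l \<in> L}"
    unfolding additive_subgroup_def
  proof (intro conjI ballI)
    show "0 \<in> {m * r + l | m l. m \<in> M \<and> l \<in> L}"
      using L M unfolding left_ideal_def additive_subgroup_def
      by (auto intro!: exI[of _ 0])
  next
    fix a b assume "a \<in> {m * r + l | m l. m \<in> M \<and> l \<in> L}" "b \<in> {m * r + l | m l. m \<in> M \<and> l \<in> L}"
    then obtain m l m' l' where "a = m * r + l" "b = m' * r + l'" "m \<in> M" "l \<in> L" "m' \<in> M" "l' \<in> L"
      by blast
    moreover from this have "a + b = (m + m') * r + (l + l')"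
      by (simp add: algebra_simps)
    ultimately show "a + b \<in> {m * r + l | m l. m \<in> M \<and> l \<in> L}"
      using L M unfolding left_ideal_def additive_subgroup_def by blast
  next
    fix a assume "a \<in> {m * r + l | m l. m \<in> M \<and> l \<in> L}"
    then obtain m l where "a = m * r + l" "m \<in> M" "l \<in> L"
      by blast
    moreover from this have "- a = (- m) * r + (- l)"
      by (simp add: algebra_simps)
    ultimately show "- a \<in> {m * r + l | m l. m \<in> M \<and> l \<in> L}"
      using L M unfolding left_ideal_def additive_subgroup_def by blast
  qed
  moreover have "x * (m * r + l) = (x * m) * r + x * l" for x m l
    by (simp add: algebra_simps)
  ultimately show ?thesis
    using L M unfolding left_ideal_def by fastforce
qed

text \<open>The left ideal \<open>M * r + L\<close> contains \<open>L\<close> and also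
  \<open>m * r\<close>, which lies outside \<open>L\<close>, so by maximality it is the whole
  ring.\<close>

lemma maximal_left_ideal_add_principal:
  assumes L: "maximal_left_ideal L" and M: "left_ideal M" and m: "m \<in> M" "m * r \<notin> L"
  shows "\<exists>m\<in>M. x - m * r \<in> L"
proof -
  let ?S = "{m * r + l | m l. m \<in> M \<and> l \<in> L}"
  have lL: "left_ideal L"
    using L by (simp add: maximal_left_ideal_def)
  have 0: "0 \<in> L" "0 \<in> M"
    using lL M by (simp_all add: left_ideal_def additive_subgroup_def)
  have "left_ideal ?S"
    using left_ideal_add_principal[OF lL M] .
  moreover have "L \<subseteq> ?S"
  proof
    fix l assume "l \<in> L"
    moreover have "l = 0 * r + l"
      by simp
    ultimately show "l \<in> ?S"
      using 0 by blast
  qed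
  moreover have "m * r \<in> ?S"
    using m(1) 0 by (metis (mono_tags, lifting) add.right_neutral mem_Collect_eq)
  moreover have "K = UNIV" if "left_ideal K" "L \<subseteq> K" "m * r \<in> K" for K
    using L m(2) that unfolding maximal_left_ideal_def by blast
  ultimately have "?S = UNIV"
    by blast
  then have "x \<in> ?S"
    by simp
  then obtain m' l where "x = m' * r + l" "m' \<in> M" "l \<in> L"
    by blast
  then show ?thesis
    by (intro bexI[of _ m']) simp_all
qed

lemma left_ideal_quotient:
  assumes "left_ideal L"
  shows "left_ideal {x. x * r \<in> L}"
  using assms unfolding left_ideal_def additive_subgroup_def
  by (auto simp: algebra_simps)

text \<open>
  The left ideal \<open>K = {x. x * r \<in> L}\<close> is the annihilator of the image of \<open>r\<close> in the simple module
  \<open>R / L\<close>, so it is either the whole ring or again modular and maximal.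
\<close>

lemma jacobson_radical_mult_right:
  assumes a: "a \<in> jacobson_radical"
  shows "a * r \<in> jacobson_radical"
  unfolding jacobson_radical_def
proof (intro InterI, clarify)
  fix L :: "'a set" assume "modular_left_ideal L" and max: "maximal_left_ideal L"
  then have L: "left_ideal L"
    by (simp add: maximal_left_ideal_def)
  let ?K = "{x. x * r \<in> L}"
  have K: "left_ideal ?K"
    using left_ideal_quotient[OF L] .
  show "a * r \<in> L"
  proof (cases "?K = UNIV")
    case False
    then obtain v where v: "v * r \<notin> L"
      by blast
    have U: "left_ideal (UNIV :: 'a set)"
      by (simp add: left_ideal_def additive_subgroup_def)
    \<comment> \<open>Since \<open>R * r + L\<close> is the whole ring, it contains \<open>r\<close>
      itself. The resulting \<open>u\<close> fixes \<open>r\<close> modulo \<open>L\<close> from the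
      left, which makes it a right unit modulo \<open>?K\<close>.\<close>
    obtain u where u: "r - u * r \<in> L"
      using maximal_left_ideal_add_principal[OF max U UNIV_I v] by blast
    have "(x - x * u) * r \<in> L" for x
    proof -
      have "(x - x * u) * r = x * (r - u * r)"
        by (simp add: algebra_simps)
      then show ?thesis
        using u L unfolding left_ideal_def by metis
    qed
    then have "modular_left_ideal ?K"
      using K unfolding modular_left_ideal_def by blast
    moreover have "maximal_left_ideal ?K"
      unfolding maximal_left_ideal_def
    proof (intro conjI allI impI K False)
      fix M assume M: "left_ideal M \<and> ?K \<subseteq> M"
      show "M = ?K \<or> M = UNIV"
      proof (cases "M \<subseteq> ?K")
        case False
        then obtain m where m: "m \<in> M" "m * r \<notin> L"
          by blast
        have "x \<in> M" for x
        proof -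
          \<comment> \<open>Already the multiples of \<open>r\<close> by elements of
            \<open>M\<close> fill the ring modulo \<open>L\<close>. Hence \<open>x\<close> differs
            from some \<open>m'\<close> in \<open>M\<close> by an element of \<open>?K\<close>, and
            \<open>?K\<close> is contained in \<open>M\<close>.\<close>
          obtain m' where m': "m' \<in> M" "x * r - m' * r \<in> L"
            using maximal_left_ideal_add_principal[OF max conjunct1[OF M] m] by blast
          then have "x - m' \<in> M"
            using M by (auto simp: algebra_simps)
          then have "x - m' + m' \<in> M"
            using M m'(1) unfolding left_ideal_def additive_subgroup_def by blast
          then show ?thesis
            by simp
        qed
        then show ?thesis
          by blast
      next
        case True
        then have "M = ?K"
          using M by (intro subset_antisym) simp_all
        then show ?thesis ..
      qed
    qed
    ultimately have "a \<in> ?K"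
      using a unfolding jacobson_radical_def by blast
    then show ?thesis
      by simp
  next
    case True
    then have "a \<in> ?K"
      by simp
    then show ?thesis
      by simp
  qed
qed

lemma left_ideal_Inter:
  assumes "\<And>L. L \<in> \<L> \<Longrightarrow> left_ideal L"
  shows "left_ideal (\<Inter>\<L>)"
  using assms by (simp add: left_ideal_def additive_subgroup_def)

lemma two_sided_ideal_jacobson_radical: "two_sided_ideal jacobson_radical"
proof -
  have "left_ideal jacobson_radical"
    unfolding jacobson_radical_def by (rule left_ideal_Inter) (simp add: maximal_left_ideal_def)
  then show ?thesis
    by (simp add: two_sided_ideal_def jacobson_radical_mult_right)
qed

section \<open>Ring isomorphisms and their effect on the Jacobson radical\<close>

lemma ring_iso_inv:
  assumes "ring_iso f"
  shows "ring_iso (inv f)"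
proof -
  have "bij f"
    using assms by (simp add: ring_iso_def)
  then have "f (inv f a) = a" "inv f (f c) = c" for a c
    by (simp_all add: bij_is_surj surj_f_inv_f bij_is_inj)
  then have "inv f (a + b) = inv f a + inv f b" "inv f (a * b) = inv f a * inv f b" for a b
    using assms unfolding ring_iso_def by metis+
  then show ?thesis
    using bij_imp_bij_inv[OF \<open>bij f\<close>] by (simp add: ring_iso_def)
qed

lemma ring_iso_add: "ring_iso f \<Longrightarrow> f (a + b) = f a + f b"
  by (simp add: ring_iso_def)

lemma ring_iso_zero: "ring_iso f \<Longrightarrow> f 0 = 0"
  using ring_iso_add[of f 0 0] by simp

lemma ring_iso_minus: "ring_iso f \<Longrightarrow> f (- a) = - f a"
  by (rule minus_unique[symmetric]) (simp add: ring_iso_zero flip: ring_iso_add)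

lemma ring_iso_diff: "ring_iso f \<Longrightarrow> f (a - b) = f a - f b"
  using ring_iso_add[of f a "- b"] by (simp add: ring_iso_minus)

lemma left_ideal_vimage:
  assumes "ring_iso f" "left_ideal L"
  shows "left_ideal (f -` L)"
  using assms ring_iso_zero[OF assms(1)] ring_iso_minus[OF assms(1)]
  unfolding left_ideal_def additive_subgroup_def ring_iso_def by auto

text \<open>The preimage under \<open>f\<close> of a modular maximal left ideal is again one, with
  the right unit pulled back along \<open>inv f\<close>. Being in the radical, \<open>a\<close> lies
  in all these preimages.\<close>

lemma ring_iso_jacobson_radical_mem:
  fixes f :: "'a::ring \<Rightarrow> 'b::ring"
  assumes f: "ring_iso f" and a: "a \<in> jacobson_radical"
  shows "f a \<in> jacobson_radical"
  unfolding jacobson_radical_def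
proof (intro InterI, clarify)
  fix L :: "'b set" assume L: "modular_left_ideal L" "maximal_left_ideal L"
  have bij: "bij f"
    using f by (simp add: ring_iso_def)
  have lL: "left_ideal L"
    using L by (simp add: maximal_left_ideal_def)
  have vim: "left_ideal (f -` L)"
    using left_ideal_vimage[OF f lL] .
  obtain e where e: "\<And>x. x - x * e \<in> L"
    using L by (auto simp: modular_left_ideal_def)
  have "f (x - x * inv f e) \<in> L" for x
    using e[of "f x"] f bij
    by (simp add: ring_iso_diff ring_iso_def bij_is_surj surj_f_inv_f)
  then have "modular_left_ideal (f -` L)"
    using vim unfolding modular_left_ideal_def by auto
  moreover have "maximal_left_ideal (f -` L)"
    unfolding maximal_left_ideal_def
  proof (intro conjI allI impI vim)
    show "f -` L \<noteq> UNIV"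
      using L bij unfolding maximal_left_ideal_def
      by (metis bij_is_surj surj_image_vimage_eq)
  next
    fix K assume K: "left_ideal K \<and> f -` L \<subseteq> K"
    \<comment> \<open>Maximality is known only for \<open>L\<close>, so \<open>K\<close> is
      transported to the target ring, compared with \<open>L\<close> there, and recovered as the
      preimage under \<open>f\<close>.\<close>
    have "left_ideal (inv f -` K)"
      using left_ideal_vimage[OF ring_iso_inv[OF f]] K by blast
    moreover have "L \<subseteq> inv f -` K"
      using K bij by (auto simp: subset_iff bij_is_surj surj_f_inv_f)
    ultimately have "inv f -` K = L \<or> inv f -` K = UNIV"
      using L unfolding maximal_left_ideal_def by blast
    moreover have "f -` (inv f -` K) = K"
      using bij by (auto simp: bij_is_inj)
    ultimately show "K = f -` L \<or> K = UNIV"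
      by auto
  qed
  ultimately show "f a \<in> L"
    using a unfolding jacobson_radical_def by blast
qed

lemma ring_iso_image_jacobson_radical:
  fixes f :: "'a::ring \<Rightarrow> 'b::ring"
  assumes "ring_iso f"
  shows "f ` jacobson_radical = jacobson_radical"
proof
  show "f ` jacobson_radical \<subseteq> jacobson_radical"
    using ring_iso_jacobson_radical_mem[OF assms] by blast
  show "jacobson_radical \<subseteq> f ` jacobson_radical"
  proof
    fix b :: 'b assume "b \<in> jacobson_radical"
    then have "inv f b \<in> jacobson_radical"
      using ring_iso_jacobson_radical_mem[OF ring_iso_inv[OF assms]] by blast
    moreover have "b = f (inv f b)"
      using assms by (simp add: ring_iso_def bij_is_surj surj_f_inv_f)
    ultimately show "b \<in> f ` jacobson_radical"
      by blast
  qed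
qed

section \<open>Arithmetic of cosets and induced isomorphisms of quotients\<close>

lemma mem_quot_proj_iff: "x \<in> quot_proj I a \<longleftrightarrow> x - a \<in> I"
proof
  assume "x - a \<in> I"
  moreover have "x = a + (x - a)"
    by simp
  ultimately show "x \<in> quot_proj I a"
    unfolding quot_proj_def elt_set_plus_def by blast
qed (auto simp: quot_proj_def elt_set_plus_def)

lemma quot_proj_eq_iff:
  assumes I: "additive_subgroup I"
  shows "quot_proj I a = quot_proj I b \<longleftrightarrow> a - b \<in> I"
proof
  assume "quot_proj I a = quot_proj I b"
  moreover have "a \<in> quot_proj I a"
    using I by (simp add: mem_quot_proj_iff additive_subgroup_def)
  ultimately show "a - b \<in> I"
    by (simp add: mem_quot_proj_iff)
next
  assume ab: "a - b \<in> I"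
  have "x - a \<in> I \<longleftrightarrow> x - b \<in> I" for x
  proof
    assume "x - a \<in> I"
    then have "(x - a) + (a - b) \<in> I"
      using ab I unfolding additive_subgroup_def by blast
    then show "x - b \<in> I"
      by simp
  next
    assume "x - b \<in> I"
    then have "(x - b) - (a - b) \<in> I"
      using ab by (rule additive_subgroup_diff[OF I])
    then show "x - a \<in> I"
      by simp
  qed
  then show "quot_proj I a = quot_proj I b"
    by (auto simp: mem_quot_proj_iff)
qed

lemma quot_proj_add:
  assumes "additive_subgroup I"
  shows "quot_proj I a + quot_proj I b = quot_proj I (a + b)"
proof -
  have "I + I = I"
  proof
    show "I + I \<subseteq> I"
      using assms by (auto simp: set_plus_def additive_subgroup_def)
    show "I \<subseteq> I + I"
      using assms by (intro set_zero_plus2) (auto simp: additive_subgroup_def)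
  qed
  then show ?thesis
    unfolding quot_proj_def by (simp add: set_plus_rearrange)
qed

text \<open>Replacing \<open>a\<close> and \<open>b\<close> by \<open>a + i\<close> and
  \<open>b + j\<close> changes the product by \<open>a * j + i * b + i * j\<close>, an element of
  \<open>I\<close>. All cosets in the defining union therefore coincide.\<close>

lemma quot_mult_quot_proj:
  assumes "two_sided_ideal I"
  shows "quot_mult I (quot_proj I a) (quot_proj I b) = quot_proj I (a * b)"
proof -
  note sub = two_sided_ideal_subgroup[OF assms]
  have eq: "quot_proj I (x * y) = quot_proj I (a * b)" if "x \<in> quot_proj I a" "y \<in> quot_proj I b" for x y
  proof -
    obtain i j where ij: "i \<in> I" "j \<in> I" "x = a + i" "y = b + j"
      using \<open>x \<in> quot_proj I a\<close> \<open>y \<in> quot_proj I b\<close>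
      unfolding quot_proj_def elt_set_plus_def by blast
    have "x * y - a * b = a * j + (i * b + i * j)"
      by (simp add: ij algebra_simps)
    then show ?thesis
      using assms ij unfolding quot_proj_eq_iff[OF sub]
      by (simp add: two_sided_ideal_def left_ideal_def additive_subgroup_def)
  qed
  \<comment> \<open>The index sets of the union must be nonempty for it to be the common
    coset.\<close>
  have mem: "c \<in> quot_proj I c" for c
    using sub by (simp add: mem_quot_proj_iff additive_subgroup_def)
  have "quot_mult I (quot_proj I a) (quot_proj I b) =
      (\<Union>x\<in>quot_proj I a. \<Union>y\<in>quot_proj I b. quot_proj I (a * b))"
    unfolding quot_mult_def by (intro SUP_cong refl eq)
  also have "\<dots> = quot_proj I (a * b)"
    using mem[of a] mem[of b] by blast
  finally show ?thesis .
qed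

lemma quot_proj_eq_image: "quot_proj I a = (+) a ` I"
  by (auto simp: quot_proj_def elt_set_plus_def)

lemma image_quot_proj:
  assumes "ring_iso f"
  shows "f ` quot_proj I a = quot_proj (f ` I) (f a)"
  using assms by (simp add: quot_proj_eq_image image_image ring_iso_def)

text \<open>Taking the induced map to be the elementwise image of cosets avoids a choice of
  representatives. Its injectivity is that of the image operation of an injective function.\<close>

lemma quot_ring_iso_image:
  assumes f: "ring_iso f" and I: "two_sided_ideal I" and J: "two_sided_ideal (f ` I)"
  shows "quot_ring_iso I (f ` I) ((`) f)"
  unfolding quot_ring_iso_def
proof (intro conjI ballI)
  have bij: "bij f"
    using f by (simp add: ring_iso_def)
  have "(`) f ` quot_carrier I = quot_carrier (f ` I)"
    unfolding quot_carrier_def image_image image_quot_proj[OF f]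
    using bij_is_surj[OF bij] by (metis image_image)
  moreover have "inj_on ((`) f) (quot_carrier I)"
    using bij by (intro inj_onI) (simp add: bij_is_inj inj_image_eq_iff)
  ultimately show "bij_betw ((`) f) (quot_carrier I) (quot_carrier (f ` I))"
    by (simp add: bij_betw_def)
next
  fix A B assume "A \<in> quot_carrier I" "B \<in> quot_carrier I"
  then obtain a b where AB: "A = quot_proj I a" "B = quot_proj I b"
    unfolding quot_carrier_def by blast
  have hom: "f (a + b) = f a + f b" "f (a * b) = f a * f b"
    using f by (simp_all add: ring_iso_def)
  show "f ` (A + B) = f ` A + f ` B"
    by (simp add: AB image_quot_proj[OF f] quot_proj_add two_sided_ideal_subgroup I J hom)
  show "f ` quot_mult I A B = quot_mult (f ` I) (f ` A) (f ` B)"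
    by (simp add: AB image_quot_proj[OF f] quot_mult_quot_proj I J hom)
qed

subsection \<open>Homogeneous components\<close>

definition component :: "('s \<Rightarrow> 'a::ring set) \<Rightarrow> 'a \<Rightarrow> 's \<Rightarrow> 'a" where
  "component R a = (THE f. (\<forall>s. f s \<in> R s) \<and> finite {s. f s \<noteq> 0} \<and> a = (\<Sum>s | f s \<noteq> 0. f s))"

context
  fixes R :: "'s::semigroup_mult \<Rightarrow> 'a::ring set"
  assumes R: "graded_ring R"
begin

lemma component_subgroup: "additive_subgroup (R s)"
  using R by (simp add: graded_ring_def internal_direct_sum_def)

lemma component_ex1:
  "\<exists>!f. (\<forall>s. f s \<in> R s) \<and> finite {s. f s \<noteq> 0} \<and> a = (\<Sum>s | f s \<noteq> 0. f s)"
  using R unfolding graded_ring_def internal_direct_sum_def by blast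

lemma
  shows component_mem: "component R a s \<in> R s"
    and finite_component: "finite {s. component R a s \<noteq> 0}"
    and component_sum: "a = (\<Sum>s | component R a s \<noteq> 0. component R a s)"
  using theI'[OF component_ex1[of a]] unfolding component_def[symmetric] by blast+

text \<open>The range \<open>A\<close> may exceed the support of \<open>f\<close>, so that several
  families can be summed over one common finite set.\<close>

lemma component_unique:
  assumes f: "\<And>s. f s \<in> R s" and fin: "finite A" and "{s. f s \<noteq> 0} \<subseteq> A" and a: "a = sum f A"
  shows "component R a = f"
proof -
  have "a = (\<Sum>s | f s \<noteq> 0. f s)"
    unfolding a using assms by (intro sum.mono_neutral_right) auto
  moreover have "finite {s. f s \<noteq> 0}"
    using assms finite_subset by blast
  ultimately show ?thesis
    unfolding component_def using f component_ex1 by (intro the1_equality) auto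
qed

lemma component_add: "component R (a + b) s = component R a s + component R b s"
proof -
  \<comment> \<open>Cancellation can make the support of the sum smaller than this union, but never
    larger.\<close>
  let ?A = "{s. component R a s \<noteq> 0} \<union> {s. component R b s \<noteq> 0}"
  have fin: "finite ?A"
    by (simp add: finite_component)
  have "a = sum (component R a) ?A" "b = sum (component R b) ?A"
    by (subst component_sum, intro sum.mono_neutral_left fin; auto)+
  then have "a + b = (\<Sum>s\<in>?A. component R a s + component R b s)"
    by (simp add: sum.distrib)
  then have "component R (a + b) = (\<lambda>s. component R a s + component R b s)"
    using component_mem component_subgroup fin
    by (intro component_unique[of _ ?A]) (auto simp: additive_subgroup_def)
  then show ?thesis
    by simp
qed

lemma component_homogeneous:
  assumes "a \<in> R s"
  shows "component R a t = (if t = s then a else 0)"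
proof -
  have "component R a = (\<lambda>t. if t = s then a else 0)"
    using assms component_subgroup
    by (intro component_unique[of _ "{s}"]) (auto simp: additive_subgroup_def)
  then show ?thesis
    by simp
qed

lemma component_eqI:
  assumes "\<And>s. component R a s = component R b s"
  shows "a = b"
proof -
  have "component R a = component R b"
    using assms by blast
  then show ?thesis
    using component_sum by metis
qed

text \<open>Every element is a finite sum of its components. The empty sum falls under
  \<open>hom\<close>, as \<open>0\<close> lies in every component.\<close>

lemma graded_induct [case_names homogeneous add]:
  assumes hom: "\<And>s a. a \<in> R s \<Longrightarrow> P a" and add: "\<And>a b. P a \<Longrightarrow> P b \<Longrightarrow> P (a + b)"
  shows "P a"
proof -
  have "P 0"
    using hom component_subgroup unfolding additive_subgroup_def by blast
  then have "P (sum (component R a) A)" for A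
    by (induction A rule: infinite_finite_induct) (auto intro: add hom component_mem)
  then show ?thesis
    using component_sum by metis
qed

text \<open>This set is the largest homogeneous subgroup inside \<open>I\<close>. A component of a
  component is that component or \<open>0\<close>, so the decomposition in \<open>R\<close> stays
  within the set, and its uniqueness is inherited.\<close>

lemma homogeneous_components_mem:
  assumes I: "additive_subgroup I"
  shows "homogeneous R {a. \<forall>s. component R a s \<in> I}" (is "homogeneous R ?H")
  unfolding homogeneous_def internal_direct_sum_def
proof (intro conjI allI ballI)
  have zero: "component R 0 s = 0" for s
    using component_homogeneous[of 0 s s] component_subgroup[of s]
    by (simp add: additive_subgroup_def)
  have minus: "component R (- a) s = - component R a s" for a s
    using component_add[of a "- a" s] zero by (intro minus_unique[symmetric]) simp
  show sub: "additive_subgroup ?H"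
    using I by (simp add: additive_subgroup_def component_add zero minus)
  show "additive_subgroup (?H \<inter> R s)" for s
    using sub component_subgroup[of s] by (auto simp: additive_subgroup_def)
  show "?H \<inter> R s \<subseteq> ?H" for s
    by blast
  fix a assume a: "a \<in> ?H"
  have "component R a s \<in> ?H" for s
    using a I component_homogeneous[OF component_mem] by (simp add: additive_subgroup_def)
  then show "\<exists>!f. (\<forall>s. f s \<in> ?H \<inter> R s) \<and> finite {s. f s \<noteq> 0} \<and> a = (\<Sum>s | f s \<noteq> 0. f s)"
    using component_mem finite_component component_sum[of a] component_ex1[of a]
    by (intro ex1I[of _ "component R a"]) blast+
qed

text \<open>By additivity the multiplier may be taken homogeneous. Its products with the components
  of \<open>a\<close> are then homogeneous elements of \<open>I\<close>, hence in the set. They are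
  treated one by one because a semigroup need not be cancellative: products from different degrees
  may land in the same degree.\<close>

lemma two_sided_ideal_components_mem:
  assumes I: "two_sided_ideal I"
  shows "two_sided_ideal {a. \<forall>s. component R a s \<in> I}"
proof -
  define H where "H = {a. \<forall>s. component R a s \<in> I}"
  note subI = two_sided_ideal_subgroup[OF I]
  have H: "additive_subgroup H"
    using homogeneous_components_mem[OF subI] by (simp add: homogeneous_def H_def)
  have homog: "x \<in> H" if "x \<in> R s" "x \<in> I" for x s
    using that subI component_homogeneous by (simp add: additive_subgroup_def H_def)
  have "r * a \<in> H \<and> a * r \<in> H" if "a \<in> H" for r a
  proof (induction r rule: graded_induct)
    case (homogeneous t r)
    let ?A = "{s. component R a s \<noteq> 0}"
    have "r * component R a s \<in> H" "component R a s * r \<in> H" for s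
    proof -
      have *: "r * component R a s \<in> R (t * s)" "component R a s * r \<in> R (s * t)"
        using R component_mem[of a s] homogeneous by (simp_all add: graded_ring_def)
      have "r * component R a s \<in> I" "component R a s * r \<in> I"
        using \<open>a \<in> H\<close> I by (simp_all add: H_def two_sided_ideal_def left_ideal_def)
      then show "r * component R a s \<in> H" "component R a s * r \<in> H"
        using homog[OF *(1)] homog[OF *(2)] by blast+
    qed
    then have "(\<Sum>s\<in>?A. r * component R a s) \<in> H" "(\<Sum>s\<in>?A. component R a s * r) \<in> H"
      by (intro additive_subgroup_sum[OF H]; blast)+
    then have "r * sum (component R a) ?A \<in> H" "sum (component R a) ?A * r \<in> H"
      by (simp_all only: sum_distrib_left sum_distrib_right)
    then show ?case
      by (simp only: component_sum[of a, symmetric] simp_thms)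
  next
    case (add r r')
    then have "r * a + r' * a \<in> H" "a * r + a * r' \<in> H"
      using H by (simp_all add: additive_subgroup_def)
    then show ?case
      by (simp add: distrib_left distrib_right)
  qed
  then have "two_sided_ideal H"
    using H by (simp add: two_sided_ideal_def left_ideal_def)
  then show ?thesis
    unfolding H_def .
qed

end

text \<open>The set \<open>?H\<close> is a homogeneous ideal inside the proper ideal
  \<open>I\<close>, so graded simplicity makes it zero, and it contains every homogeneous element of
  \<open>I\<close>.\<close>

lemma graded_simple_component_Int_ideal:
  assumes R: "graded_simple R" and I: "two_sided_ideal I" "I \<noteq> UNIV" and a: "a \<in> R s" "a \<in> I"
  shows "a = 0"
proof -
  have gr: "graded_ring R"
    using R by (simp add: graded_simple_def)
  note sub = two_sided_ideal_subgroup[OF I(1)]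
  let ?H = "{a. \<forall>s. component R a s \<in> I}"
  have "x \<in> I" if "x \<in> ?H" for x
  proof -
    have "(\<Sum>s | component R x s \<noteq> 0. component R x s) \<in> I"
      using that by (intro additive_subgroup_sum[OF sub]) auto
    then show ?thesis
      using component_sum[OF gr] by metis
  qed
  then have "?H \<noteq> UNIV"
    using I(2) by blast
  then have "?H = {0}"
    using R two_sided_ideal_components_mem[OF gr I(1)] homogeneous_components_mem[OF gr sub]
    unfolding graded_simple_def by blast
  moreover have "a \<in> ?H"
    using a sub component_homogeneous[OF gr a(1)] by (simp add: additive_subgroup_def)
  ultimately show ?thesis
    by blast
qed

subsection \<open>Gluing and restricting to components\<close>

text \<open>The partners of the components of \<open>a\<close> form a family of finite support, and
  \<open>b\<close> is its sum.\<close>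

lemma graded_relation_ex1:
  assumes R1: "graded_ring R1" and R2: "graded_ring R2"
    and ex1: "\<And>s x. x \<in> R1 s \<Longrightarrow> \<exists>!y. y \<in> R2 s \<and> C x y" and zero: "C 0 0"
  shows "\<exists>!b. \<forall>s. C (component R1 a s) (component R2 b s)"
proof -
  define f where "f s = (THE y. y \<in> R2 s \<and> C (component R1 a s) y)" for s
  have f: "f s \<in> R2 s" "C (component R1 a s) (f s)" for s
    using theI'[OF ex1[OF component_mem[OF R1, of a s]]] by (auto simp: f_def)
  have unique: "y = f s" if "y \<in> R2 s" "C (component R1 a s) y" for s y
    using ex1[OF component_mem[OF R1, of a s]] f that by blast
  \<comment> \<open>By \<open>zero\<close>, \<open>0\<close> is a partner of \<open>0\<close>, and
    partners are unique. So \<open>f\<close> has no support outside that of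
    \<open>a\<close>.\<close>
  have "f s = 0" if "component R1 a s = 0" for s
    using unique[of 0 s] that zero component_subgroup[OF R2, of s]
    by (simp add: additive_subgroup_def)
  then have supp: "{s. f s \<noteq> 0} \<subseteq> {s. component R1 a s \<noteq> 0}"
    by auto
  have comp: "component R2 (\<Sum>s | component R1 a s \<noteq> 0. f s) = f"
    by (rule component_unique[OF R2 f(1) finite_component[OF R1] supp refl])
  show ?thesis
  proof (rule ex1I)
    show "\<forall>s. C (component R1 a s) (component R2 (\<Sum>s | component R1 a s \<noteq> 0. f s) s)"
      by (simp add: comp f)
  next
    fix b assume "\<forall>s. C (component R1 a s) (component R2 b s)"
    then have "component R2 b s = f s" for s
      using unique component_mem[OF R2] by blast
    then have "component R2 b = component R2 (\<Sum>s | component R1 a s \<noteq> 0. f s)"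
      by (simp add: comp fun_eq_iff)
    then show "b = (\<Sum>s | component R1 a s \<noteq> 0. f s)"
      by (simp add: component_eqI[OF R2])
  qed
qed

text \<open>In the application, \<open>C\<close> relates elements with corresponding images modulo
  the radicals. Such a relation respects sums and products but is single-valued only inside a
  component, so \<open>\<phi>\<close> is defined by \<open>T\<close>, which imposes \<open>C\<close>
  degree by degree. Additivity then gives \<open>C\<close> for the whole elements.\<close>

lemma graded_ring_iso_of_relation:
  assumes R1: "graded_ring R1" and R2: "graded_ring R2"
    and ex1: "\<And>s x. x \<in> R1 s \<Longrightarrow> \<exists>!y. y \<in> R2 s \<and> C x y"
    and ex1': "\<And>s y. y \<in> R2 s \<Longrightarrow> \<exists>!x. x \<in> R1 s \<and> C x y"
    and zero: "C 0 0"
    and add: "\<And>a b a' b'. C a b \<Longrightarrow> C a' b' \<Longrightarrow> C (a + a') (b + b')"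
    and mult: "\<And>a b a' b'. C a b \<Longrightarrow> C a' b' \<Longrightarrow> C (a * a') (b * b')"
  shows "\<exists>\<phi>. graded_ring_iso R1 R2 \<phi> \<and> (\<forall>a. C a (\<phi> a))"
proof -
  define T where "T a b \<longleftrightarrow> (\<forall>s. C (component R1 a s) (component R2 b s))" for a b
  have T: "\<exists>!b. T a b" for a
    unfolding T_def by (rule graded_relation_ex1[OF R1 R2, where C = C, OF ex1 zero])
  \<comment> \<open>Exchanging the two rings shows that \<open>T\<close> is also single-valued and
    total backwards, which yields bijectivity of \<open>\<phi>\<close>.\<close>
  have T': "\<exists>!a. T a b" for b
    unfolding T_def by (rule graded_relation_ex1[OF R2 R1, where C = "\<lambda>y x. C x y", OF ex1' zero])
  define \<phi> where "\<phi> a = (THE b. T a b)" for a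
  have \<phi>: "T a b \<longleftrightarrow> \<phi> a = b" for a b
    unfolding \<phi>_def using theI'[OF T] T by blast
  have bij: "bij \<phi>"
    using T' unfolding \<phi> bij_def inj_def surj_def by metis
  have \<phi>_add: "\<phi> (a + b) = \<phi> a + \<phi> b" for a b
  proof -
    have "T a (\<phi> a)" "T b (\<phi> b)"
      by (simp_all add: \<phi>)
    then have "T (a + b) (\<phi> a + \<phi> b)"
      by (simp add: T_def component_add R1 R2 add)
    then show ?thesis
      by (simp add: \<phi>)
  qed
  have \<phi>_hom: "\<phi> a \<in> R2 s \<and> C a (\<phi> a)" if "a \<in> R1 s" for a s
  proof -
    obtain b where b: "b \<in> R2 s" "C a b"
      using ex1[OF \<open>a \<in> R1 s\<close>] by blast
    then have "T a b"
      using \<open>a \<in> R1 s\<close> zero by (simp add: T_def component_homogeneous[OF R1] component_homogeneous[OF R2])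
    then show ?thesis
      using b by (simp add: \<phi>)
  qed
  have \<phi>_C: "C a (\<phi> a)" for a
  proof (induction a rule: graded_induct[OF R1])
    case (1 s a)
    then show ?case using \<phi>_hom by blast
  next
    case (2 a b)
    then show ?case by (simp add: \<phi>_add add)
  qed
  \<comment> \<open>Both sides are additive in each argument, so two nested inductions leave only
    homogeneous \<open>a\<close> and \<open>b\<close>.\<close>
  have \<phi>_mult: "\<phi> (a * b) = \<phi> a * \<phi> b" for a b
  proof (induction a rule: graded_induct[OF R1])
    case (1 s a)
    show ?case
    proof (induction b rule: graded_induct[OF R1])
      case (1 t b)
      have ab: "a * b \<in> R1 (s * t)"
        using R1 \<open>a \<in> R1 s\<close> \<open>b \<in> R1 t\<close> by (simp add: graded_ring_def)
      have "\<phi> a * \<phi> b \<in> R2 (s * t)"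
        using R2 \<phi>_hom \<open>a \<in> R1 s\<close> \<open>b \<in> R1 t\<close> by (simp add: graded_ring_def)
      moreover have "C (a * b) (\<phi> a * \<phi> b)"
        by (simp add: mult \<phi>_C)
      ultimately show ?case
        using ex1[OF ab] \<phi>_hom[OF ab] by blast
    qed (simp add: distrib_left \<phi>_add)
  qed (simp add: distrib_right \<phi>_add)
  show ?thesis
    using bij \<phi>_add \<phi>_mult \<phi>_hom \<phi>_C unfolding graded_ring_iso_def ring_iso_def by blast
qed

text \<open>A graded map commutes with taking components. If \<open>f a\<close> is homogeneous of
  degree \<open>s\<close>, it is thus already the image of the component of \<open>a\<close> in
  degree \<open>s\<close>.\<close>

lemma graded_ring_iso_image:
  assumes R1: "graded_ring R1" and R2: "graded_ring R2" and f: "graded_ring_iso R1 R2 f"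
  shows "f ` R1 s = R2 s"
proof
  show "f ` R1 s \<subseteq> R2 s"
    using f by (simp add: graded_ring_iso_def)
  have iso: "ring_iso f"
    using f by (simp add: graded_ring_iso_def)
  have comp: "component R2 (f a) s = f (component R1 a s)" for a s
  proof (induction a rule: graded_induct[OF R1])
    case (1 t a)
    then have "f a \<in> R2 t"
      using f by (auto simp: graded_ring_iso_def)
    with 1 show ?case
      by (simp add: component_homogeneous[OF R1] component_homogeneous[OF R2] ring_iso_zero[OF iso])
  next
    case (2 a b)
    then show ?case
      using iso by (simp add: component_add R1 R2 ring_iso_def)
  qed
  show "R2 s \<subseteq> f ` R1 s"
  proof
    fix b assume b: "b \<in> R2 s"
    obtain a where a: "b = f a"
      using iso unfolding ring_iso_def bij_def by blast
    then have "b = f (component R1 a s)"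
      using component_homogeneous[OF R2 b, of s] by (simp add: comp)
    then show "b \<in> f ` R1 s"
      using component_mem[OF R1] by blast
  qed
qed

section \<open>Lifting isomorphisms of the radical quotients, and inducing them\<close>

theorem theorem2p3:
  fixes R1 :: "'s::semigroup_mult \<Rightarrow> 'a::ring set"
    and R2 :: "'s \<Rightarrow> 'b::ring set"
  assumes "graded_simple R1" and "graded_simple R2"
    and "(UNIV :: 'a set) \<noteq> jacobson_radical" and "(UNIV :: 'b set) \<noteq> jacobson_radical"
  shows
    "(\<forall>\<psi> :: 'a set \<Rightarrow> 'b set.
        quot_ring_iso jacobson_radical jacobson_radical \<psi> \<and>
        (\<forall>s. \<psi> ` (\<pi>\<^sub>J ` R1 s) = \<pi>\<^sub>J ` R2 s)
        \<longrightarrow> (\<exists>\<phi>. graded_ring_iso R1 R2 \<phi> \<and> (\<forall>a. \<pi>\<^sub>J (\<phi> a) = \<psi> (\<pi>\<^sub>J a)))) \<and>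
     (\<forall>\<phi>. graded_ring_iso R1 R2 \<phi> \<longrightarrow>
        (\<exists>\<psi> :: 'a set \<Rightarrow> 'b set.
           (\<forall>a. \<psi> (\<pi>\<^sub>J a) = \<pi>\<^sub>J (\<phi> a)) \<and>
           quot_ring_iso jacobson_radical jacobson_radical \<psi> \<and>
           (\<forall>s. \<psi> ` (\<pi>\<^sub>J ` R1 s) = \<pi>\<^sub>J ` R2 s)))"
proof (intro conjI allI impI)
  note J1 = two_sided_ideal_jacobson_radical[where 'a = 'a]
  note J2 = two_sided_ideal_jacobson_radical[where 'a = 'b]
  note sub1 = two_sided_ideal_subgroup[OF J1] and sub2 = two_sided_ideal_subgroup[OF J2]
  have R1: "graded_ring R1" and R2: "graded_ring R2"
    using assms(1,2) by (simp_all add: graded_simple_def)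
  {
    fix \<psi> :: "'a set \<Rightarrow> 'b set"
    assume "quot_ring_iso jacobson_radical jacobson_radical \<psi> \<and> (\<forall>s. \<psi> ` (\<pi>\<^sub>J ` R1 s) = \<pi>\<^sub>J ` R2 s)"
    then have \<psi>: "quot_ring_iso jacobson_radical jacobson_radical \<psi>"
      and img: "\<psi> ` (\<pi>\<^sub>J ` R1 s) = \<pi>\<^sub>J ` R2 s" for s
      by blast+
    have carrier: "\<pi>\<^sub>J a \<in> quot_carrier jacobson_radical" for a :: 'a
      by (simp add: quot_carrier_def)
    have \<psi>_add: "\<psi> (\<pi>\<^sub>J (a + b)) = \<psi> (\<pi>\<^sub>J a) + \<psi> (\<pi>\<^sub>J b)" for a b
      using \<psi> carrier unfolding quot_ring_iso_def quot_proj_add[OF sub1, symmetric] by blast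
    have \<psi>_mult: "\<psi> (\<pi>\<^sub>J (a * b)) = quot_mult jacobson_radical (\<psi> (\<pi>\<^sub>J a)) (\<psi> (\<pi>\<^sub>J b))" for a b
      using \<psi> carrier unfolding quot_ring_iso_def quot_mult_quot_proj[OF J1, symmetric] by blast
    have \<psi>_inj: "\<pi>\<^sub>J a = \<pi>\<^sub>J b" if "\<psi> (\<pi>\<^sub>J a) = \<psi> (\<pi>\<^sub>J b)" for a b
      using \<psi> carrier that unfolding quot_ring_iso_def bij_betw_def inj_on_def by blast
    \<comment> \<open>The difference \<open>x - y\<close> is homogeneous and lies in the radical, a
      proper ideal.\<close>
    have inj1: "x = y" if "x \<in> R1 s" "y \<in> R1 s" "\<pi>\<^sub>J x = \<pi>\<^sub>J y" for x y s
      using graded_simple_component_Int_ideal[OF assms(1) J1 assms(3)[symmetric], of "x - y" s] that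
        additive_subgroup_diff[OF component_subgroup[OF R1]]
      by (simp add: quot_proj_eq_iff[OF sub1])
    have inj2: "x = y" if "x \<in> R2 s" "y \<in> R2 s" "\<pi>\<^sub>J x = \<pi>\<^sub>J y" for x y s
      using graded_simple_component_Int_ideal[OF assms(2) J2 assms(4)[symmetric], of "x - y" s] that
        additive_subgroup_diff[OF component_subgroup[OF R2]]
      by (simp add: quot_proj_eq_iff[OF sub2])
    show "\<exists>\<phi>. graded_ring_iso R1 R2 \<phi> \<and> (\<forall>a. \<pi>\<^sub>J (\<phi> a) = \<psi> (\<pi>\<^sub>J a))"
    proof (rule graded_ring_iso_of_relation[OF R1 R2, where C = "\<lambda>x y. \<pi>\<^sub>J y = \<psi> (\<pi>\<^sub>J x)"])
      fix s x assume "x \<in> R1 s"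
      then have "\<psi> (\<pi>\<^sub>J x) \<in> \<pi>\<^sub>J ` R2 s"
        using img by blast
      then show "\<exists>!y. y \<in> R2 s \<and> \<pi>\<^sub>J y = \<psi> (\<pi>\<^sub>J x)"
        using inj2 by (metis imageE)
    next
      fix s y assume "y \<in> R2 s"
      then have "\<pi>\<^sub>J y \<in> \<psi> ` (\<pi>\<^sub>J ` R1 s)"
        unfolding img by (rule imageI)
      then obtain x where x: "x \<in> R1 s" "\<pi>\<^sub>J y = \<psi> (\<pi>\<^sub>J x)"
        by blast
      \<comment> \<open>Injectivity of \<open>\<psi>\<close> on cosets first makes \<open>x\<close>
        and \<open>x'\<close> congruent modulo the radical; \<open>inj1\<close> then makes them
        equal.\<close>
      have "x' = x" if "x' \<in> R1 s" "\<pi>\<^sub>J y = \<psi> (\<pi>\<^sub>J x')" for x'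
        using inj1[OF that(1) x(1)] \<psi>_inj[of x' x] x(2) that(2) by simp
      then show "\<exists>!x. x \<in> R1 s \<and> \<pi>\<^sub>J y = \<psi> (\<pi>\<^sub>J x)"
        using x by blast
    next
      \<comment> \<open>That \<open>\<psi>\<close> preserves zero follows from additivity: the image
        of the zero coset is a coset equal to its own double.\<close>
      have "\<psi> (\<pi>\<^sub>J 0) \<in> quot_carrier jacobson_radical"
        using \<psi> carrier unfolding quot_ring_iso_def bij_betw_def by blast
      then obtain z where z: "\<psi> (\<pi>\<^sub>J 0) = \<pi>\<^sub>J z"
        by (auto simp: quot_carrier_def)
      then have "\<pi>\<^sub>J (z + z) = \<pi>\<^sub>J z"
        using \<psi>_add[of 0 0] by (simp add: quot_proj_add[OF sub2])
      then have "\<pi>\<^sub>J z = \<pi>\<^sub>J 0"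
        by (simp add: quot_proj_eq_iff[OF sub2])
      then show "\<pi>\<^sub>J 0 = \<psi> (\<pi>\<^sub>J 0)"
        by (simp add: z)
    qed (simp_all add: \<psi>_add \<psi>_mult flip: quot_proj_add[OF sub2] quot_mult_quot_proj[OF J2])
  next
    fix \<phi> :: "'a \<Rightarrow> 'b" assume \<phi>: "graded_ring_iso R1 R2 \<phi>"
    then have iso: "ring_iso \<phi>"
      by (simp add: graded_ring_iso_def)
    note J = ring_iso_image_jacobson_radical[OF iso]
    \<comment> \<open>Since \<open>\<phi>\<close> maps the radical onto the radical, it maps cosets
      onto cosets; the elementwise image serves as \<open>\<psi>\<close>.\<close>
    have comm: "\<phi> ` \<pi>\<^sub>J a = \<pi>\<^sub>J (\<phi> a)" for a
      by (simp add: image_quot_proj[OF iso] J)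
    have "(`) \<phi> ` (\<pi>\<^sub>J ` R1 s) = \<pi>\<^sub>J ` R2 s" for s
      unfolding graded_ring_iso_image[OF R1 R2 \<phi>, of s, symmetric] image_image comm ..
    moreover have "quot_ring_iso jacobson_radical jacobson_radical ((`) \<phi>)"
      using quot_ring_iso_image[OF iso J1] J J2 by simp
    ultimately show "\<exists>\<psi> :: 'a set \<Rightarrow> 'b set. (\<forall>a. \<psi> (\<pi>\<^sub>J a) = \<pi>\<^sub>J (\<phi> a)) \<and>
        quot_ring_iso jacobson_radical jacobson_radical \<psi> \<and> (\<forall>s. \<psi> ` (\<pi>\<^sub>J ` R1 s) = \<pi>\<^sub>J ` R2 s)"
      using comm by blast
  }
qed

end
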